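(* Let $\mathcal{D}'_\Gamma$ be the space of distributions having their wavefront sets in a specified closed cone $\Gamma$, equipped with its normal topology. Let $F$ be a quasi-(LB) Hausdorff locally convex space with quasi-(LB) representation $\{A_\alpha:\alpha\in\mathbb{N}^{\mathbb{N}}\}$, let $H$ be a fast closed linear subspace of $F$, and let $T:H\to\mathcal{D}'_\Gamma$ be a surjective linear map whose graph is closed in $H\times\mathcal{D}'_\Gamma$. For $k,m_1,\dots,m_k\in\mathbb{N}$ put $$V_{m_1\cdots m_k}=\bigcup\{T(A_\alpha\cap H):\alpha=(a_n)\in\mathbb{N}^{\mathbb{N}},\ a_n=m_n \text{ for } n=1,\dots,k\},$$ and assume that there is a sequence $(r_k)\in\mathbb{N}^{\mathbb{N}}$ such that for every $k\in\mathbb{N}$ the closure $\overline{V_{r_1\cdots r_k}}$ in $\mathcal{D}'_\Gamma$ is a neighborhood of $0$ in $\mathcal{D}'_\Gamma$. Then for every sequence $(y_n)$ converging to $0$ in $\mathcal{D}'_\Gamma$ there exist $\beta\in\mathbb{N}^{\mathbb{N}}$ and a sequence $(u_n)$ in $F_{A_\beta}\cap H$ such that $(u_n)$ is fast convergent in $F$ and $T(u_n)=y_n$ for all $n\in\mathbb{N}$.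
   Context: All spaces are Hausdorff locally convex topological vector spaces over $\mathbb{K}=\mathbb{R}$ or $\mathbb{C}$. A disk is an absolutely convex (convex and balanced) set. The space $\mathcal{D}'_\Gamma$. Let $\Omega\subset\mathbb{R}^d$ be open and let $\Gamma\subset\Omega\times(\mathbb{R}^d\setminus\{0\})$ be a closed cone, i.e. a relatively closed subset with $(x,\lambda\xi)\in\Gamma$ whenever $(x,\xi)\in\Gamma$ and $\lambda>0$. Then $\mathcal{D}'_\Gamma=\{u\in\mathcal{D}'(\Omega):\mathrm{WF}(u)\subset\Gamma\}$, where $\mathrm{WF}(u)$ is the ($C^\infty$) wavefront set of $u$. The normal topology on $\mathcal{D}'_\Gamma$ is the locally convex topology generated by the seminorms $p_B(u)=\sup_{f\in B}|\langle u,f\rangle|$, for all bounded sets $B\subset\mathcal{D}(\Omega)$, together with the seminorms $\|u\|_{N,V,\chi}=\sup_{\xi\in V}(1+|\xi|)^N|\widehat{u\chi}(\xi)|$, for all integers $N\ge 0$, all $\chi\in\mathcal{D}(\Omega)$ and all closed cones $V\subset\mathbb{R}^d$ with $(\operatorname{supp}\chi\times V)\cap\Gamma=\emptyset$. Banach disks. For a bounded disk $B$ in a space $F$, $F_B$ denotes the linear span of $B$ with the norm $\|x\|_B=\inf\{t>0:x\in tB\}$. $B$ is a Banach disk if $(F_B,\|\cdot\|_B)$ is complete. A sequence in $F$ is fast convergent (to $y$) if for some Banach disk $B$ in $F$ it converges to $y$ in $(F_B,\|\cdot\|_B)$. A linear subspace $H$ of $F$ is fast closed if for every Banach disk $B$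 of $F$, $H\cap F_B$ is a closed subspace of $F$. Quasi-(LB) spaces. For $\alpha=(a_n),\beta=(b_n)\in\mathbb{N}^{\mathbb{N}}$ write $\alpha\le\beta$ if $a_n\le b_n$ for all $n$. A quasi-(LB) representation on $F$ is a family $\{A_\alpha:\alpha\in\mathbb{N}^{\mathbb{N}}\}$ of Banach disks of $F$ with $\bigcup_\alpha A_\alpha=F$ and $A_\alpha\subset A_\beta$ whenever $\alpha\le\beta$. A space having such a representation is a quasi-(LB) space. *)

theory Defs
  imports "HOL-Analysis.Analysis" "HOL-Library.Function_Algebras"
begin

section \<open>The scalar field\<close>

text \<open>
  The models of this class are the real and the complex numbers: \<open>cplx\<close> is an isometric embedding
  of real algebras into the complex numbers, so its range is one of the two
  (lemma \<open>range_cplx\<close>). It is needed because the Fourier transform of a real distribution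
  is complex valued.
\<close>

class real_or_complex = real_normed_field + euclidean_space +
  fixes cplx :: "'a \<Rightarrow> complex"
  assumes cplx_add: "cplx (x + y) = cplx x + cplx y"
    and cplx_mult: "cplx (x * y) = cplx x * cplx y"
    and cplx_scaleR: "cplx (r *\<^sub>R x) = r *\<^sub>R cplx x"
    and cplx_one: "cplx 1 = 1"
    and norm_cplx: "norm (cplx x) = norm x"

instantiation real :: real_or_complex
begin
definition "cplx (x::real) = complex_of_real x"
instance by standard (simp_all add: cplx_real_def scaleR_conv_of_real)
end

instantiation complex :: real_or_complex
begin
definition "cplx (x::complex) = x"
instance by standard (simp_all add: cplx_complex_def)
end

lemma cplx_of_real: "cplx (of_real r) = of_real r"
  by (simp add: of_real_def cplx_scaleR cplx_one)

lemma range_cplx: "range (cplx :: 'k::real_or_complex \<Rightarrow> complex) \<in> {\<real>, UNIV}"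
proof (cases "\<exists>z::'k. cplx z \<notin> \<real>")
  case True
  then obtain z :: 'k where z: "Im (cplx z) \<noteq> 0"
    by (auto simp: complex_is_Real_iff)
  have "w \<in> range (cplx :: 'k \<Rightarrow> complex)" for w
  proof -
    define b where "b = Im w / Im (cplx z)"
    define a where "a = Re w - b * Re (cplx z)"
    have "cplx (of_real a + of_real b * z) = of_real a + of_real b * cplx z"
      by (simp only: cplx_add cplx_mult cplx_of_real)
    also have "\<dots> = w"
      using z by (simp add: complex_eq_iff a_def b_def)
    finally have "cplx (of_real a + of_real b * z) = w" .
    then show ?thesis
      by (metis rangeI)
  qed
  then show ?thesis by auto
next
  case False
  then have "range (cplx :: 'k \<Rightarrow> complex) \<subseteq> \<real>"
    by auto
  moreover have "\<real> \<subseteq> range (cplx :: 'k \<Rightarrow> complex)"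
    by (metis (no_types, lifting) Reals_cases cplx_of_real rangeI subsetI)
  ultimately have "range (cplx :: 'k \<Rightarrow> complex) = \<real>"
    by blast
  then show ?thesis by simp
qed


section \<open>Locally convex spaces\<close>

definition bounded_in ::
  "('k::real_or_complex \<Rightarrow> 'v::ab_group_add \<Rightarrow> 'v) \<Rightarrow> 'v topology \<Rightarrow> 'v set \<Rightarrow> bool" where
  "bounded_in smul X B \<longleftrightarrow>
     B \<subseteq> topspace X \<and>
     (\<forall>U. openin X U \<and> 0 \<in> U \<longrightarrow> (\<exists>t>0. B \<subseteq> smul (of_real t) ` U))"

definition convex_wrt ::
  "('k::real_or_complex \<Rightarrow> 'v::ab_group_add \<Rightarrow> 'v) \<Rightarrow> 'v set \<Rightarrow> bool" where
  "convex_wrt smul C \<longleftrightarrow>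
     (\<forall>x\<in>C. \<forall>y\<in>C. \<forall>t\<in>{0..1}. smul (of_real (1 - t)) x + smul (of_real t) y \<in> C)"

definition balanced_wrt ::
  "('k::real_or_complex \<Rightarrow> 'v::ab_group_add \<Rightarrow> 'v) \<Rightarrow> 'v set \<Rightarrow> bool" where
  "balanced_wrt smul C \<longleftrightarrow> (\<forall>x\<in>C. \<forall>c. norm c \<le> 1 \<longrightarrow> smul c x \<in> C)"

definition locally_convex_space ::
  "('k::real_or_complex \<Rightarrow> 'v::ab_group_add \<Rightarrow> 'v) \<Rightarrow> 'v topology \<Rightarrow> bool" where
  "locally_convex_space smul X \<longleftrightarrow>
     vector_space smul \<and>
     topspace X = UNIV \<and>
     Hausdorff_space X \<and>
     continuous_map (prod_topology X X) X (\<lambda>(x, y). x + y) \<and>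
     continuous_map (prod_topology euclidean X) X (\<lambda>(c, x). smul c x) \<and>
     (\<forall>U. openin X U \<and> 0 \<in> U \<longrightarrow>
        (\<exists>W C. openin X W \<and> 0 \<in> W \<and> W \<subseteq> C \<and> C \<subseteq> U \<and> convex_wrt smul C))"

definition linear_map_on ::
  "('k::real_or_complex \<Rightarrow> 'v::ab_group_add \<Rightarrow> 'v) \<Rightarrow> ('k \<Rightarrow> 'w::ab_group_add \<Rightarrow> 'w) \<Rightarrow>
   'v set \<Rightarrow> ('v \<Rightarrow> 'w) \<Rightarrow> bool" where
  "linear_map_on smul1 smul2 S f \<longleftrightarrow>
     (\<forall>x\<in>S. \<forall>y\<in>S. f (x + y) = f x + f y) \<and> (\<forall>c. \<forall>x\<in>S. f (smul1 c x) = smul2 c (f x))"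

definition seminorm_on ::
  "('k::real_or_complex \<Rightarrow> 'v::ab_group_add \<Rightarrow> 'v) \<Rightarrow> 'v set \<Rightarrow> ('v \<Rightarrow> real) \<Rightarrow> bool" where
  "seminorm_on smul S p \<longleftrightarrow>
     (\<forall>x\<in>S. \<forall>y\<in>S. p (x + y) \<le> p x + p y) \<and> (\<forall>c. \<forall>x\<in>S. p (smul c x) = norm c * p x)"

definition seminorm_topology :: "'v::ab_group_add set \<Rightarrow> ('v \<Rightarrow> real) set \<Rightarrow> 'v topology" where
  "seminorm_topology S P = topology (\<lambda>U. U \<subseteq> S \<and>
     (\<forall>x\<in>U. \<exists>Q e. finite Q \<and> Q \<subseteq> P \<and> 0 < e \<and> {y\<in>S. \<forall>p\<in>Q. p (y - x) < e} \<subseteq> U))"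

lemma openin_seminorm_topology:
  "openin (seminorm_topology S P) U \<longleftrightarrow> U \<subseteq> S \<and>
     (\<forall>x\<in>U. \<exists>Q e. finite Q \<and> Q \<subseteq> P \<and> 0 < e \<and> {y\<in>S. \<forall>p\<in>Q. p (y - x) < e} \<subseteq> U)"
proof -
  let ?L = "\<lambda>U. U \<subseteq> S \<and>
     (\<forall>x\<in>U. \<exists>Q e. finite Q \<and> Q \<subseteq> P \<and> (0::real) < e \<and> {y\<in>S. \<forall>p\<in>Q. p (y - x) < e} \<subseteq> U)"
  have "istopology ?L"
    unfolding istopology_def
  proof (rule conjI; intro allI impI)
    fix U V assume U: "?L U" and V: "?L V"
    show "?L (U \<inter> V)"
    proof (intro conjI ballI)
      show "U \<inter> V \<subseteq> S" using U by blast
      fix x assume x: "x \<in> U \<inter> V"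
      obtain Q1 e1 where 1: "finite Q1" "Q1 \<subseteq> P" "0 < e1" "{y\<in>S. \<forall>p\<in>Q1. p (y - x) < e1} \<subseteq> U"
        using U x by blast
      obtain Q2 e2 where 2: "finite Q2" "Q2 \<subseteq> P" "0 < e2" "{y\<in>S. \<forall>p\<in>Q2. p (y - x) < e2} \<subseteq> V"
        using V x by blast
      have "{y\<in>S. \<forall>p\<in>Q1 \<union> Q2. p (y - x) < min e1 e2} \<subseteq> U \<inter> V"
        using 1(4) 2(4) by auto
      then show "\<exists>Q e. finite Q \<and> Q \<subseteq> P \<and> 0 < e \<and> {y\<in>S. \<forall>p\<in>Q. p (y - x) < e} \<subseteq> U \<inter> V"
        using 1 2 by (intro exI[of _ "Q1 \<union> Q2"] exI[of _ "min e1 e2"]) auto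
    qed
  next
    fix \<K> assume K: "\<forall>U\<in>\<K>. ?L U"
    show "?L (\<Union>\<K>)"
    proof (intro conjI ballI)
      show "\<Union>\<K> \<subseteq> S" using K by blast
      fix x assume "x \<in> \<Union>\<K>"
      then obtain U where U: "U \<in> \<K>" "x \<in> U" by blast
      with K obtain Q e where "finite Q" "Q \<subseteq> P" "0 < e" "{y\<in>S. \<forall>p\<in>Q. p (y - x) < e} \<subseteq> U"
        by meson
      with U show "\<exists>Q e. finite Q \<and> Q \<subseteq> P \<and> 0 < e \<and> {y\<in>S. \<forall>p\<in>Q. p (y - x) < e} \<subseteq> \<Union>\<K>"
        by (intro exI[of _ Q] exI[of _ e]) auto
    qed
  qed
  then show ?thesis
    unfolding seminorm_topology_def by (simp add: topology_inverse')
qed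

lemma topspace_seminorm_topology [simp]: "topspace (seminorm_topology S P) = S"
proof -
  have "openin (seminorm_topology S P) S"
    unfolding openin_seminorm_topology by (auto intro!: exI[of _ "{}"] exI[of _ "1::real"])
  then show ?thesis
    by (meson openin_seminorm_topology openin_subset openin_topspace subset_antisym)
qed


section \<open>Banach disks, fast convergence and quasi-(LB) spaces\<close>

text \<open>The empty set is not regarded as a disk.\<close>

definition disk :: "('k::real_or_complex \<Rightarrow> 'v::ab_group_add \<Rightarrow> 'v) \<Rightarrow> 'v set \<Rightarrow> bool" where
  "disk smul B \<longleftrightarrow> B \<noteq> {} \<and> convex_wrt smul B \<and> balanced_wrt smul B"

text \<open>Off the span of \<open>B\<close> the value is irrelevant; 0 is used there because
  \<^locale>\<open>Metric_space\<close> requires a nonnegative distance on the whole type.\<close>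

definition disk_norm ::
  "('k::real_or_complex \<Rightarrow> 'v::ab_group_add \<Rightarrow> 'v) \<Rightarrow> 'v set \<Rightarrow> 'v \<Rightarrow> real" where
  "disk_norm smul B x =
     (if x \<in> module.span smul B then Inf {t. 0 < t \<and> x \<in> smul (of_real t) ` B} else 0)"

definition disk_metric ::
  "('k::real_or_complex \<Rightarrow> 'v::ab_group_add \<Rightarrow> 'v) \<Rightarrow> 'v set \<Rightarrow> 'v metric" where
  "disk_metric smul B = metric (module.span smul B, \<lambda>x y. disk_norm smul B (x - y))"

definition banach_disk ::
  "('k::real_or_complex \<Rightarrow> 'v::ab_group_add \<Rightarrow> 'v) \<Rightarrow> 'v topology \<Rightarrow> 'v set \<Rightarrow> bool" where
  "banach_disk smul X B \<longleftrightarrow>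
     disk smul B \<and> bounded_in smul X B \<and> mcomplete_of (disk_metric smul B)"

definition fast_convergent ::
  "('k::real_or_complex \<Rightarrow> 'v::ab_group_add \<Rightarrow> 'v) \<Rightarrow> 'v topology \<Rightarrow> (nat \<Rightarrow> 'v) \<Rightarrow> bool" where
  "fast_convergent smul X u \<longleftrightarrow>
     (\<exists>B y. banach_disk smul X B \<and> range u \<subseteq> module.span smul B \<and>
        limitin (mtopology_of (disk_metric smul B)) u y sequentially)"

text \<open>Closedness is meant in the normed space spanned by the Banach disk. Closedness in the
  coarser topology of the ambient space would not even hold for the whole space in general, since
  the span of a Banach disk is usually not closed.\<close>

definition fast_closed ::
  "('k::real_or_complex \<Rightarrow> 'v::ab_group_add \<Rightarrow> 'v) \<Rightarrow> 'v topology \<Rightarrow> 'v set \<Rightarrow> bool" where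
  "fast_closed smul X H \<longleftrightarrow>
     module.subspace smul H \<and>
     (\<forall>B. banach_disk smul X B \<longrightarrow>
        closedin (mtopology_of (disk_metric smul B)) (H \<inter> module.span smul B))"

definition quasi_LB_representation ::
  "('k::real_or_complex \<Rightarrow> 'v::ab_group_add \<Rightarrow> 'v) \<Rightarrow> 'v topology \<Rightarrow>
   ((nat \<Rightarrow> nat) \<Rightarrow> 'v set) \<Rightarrow> bool" where
  "quasi_LB_representation smul X A \<longleftrightarrow>
     (\<forall>\<alpha>. banach_disk smul X (A \<alpha>)) \<and>
     (\<Union>\<alpha>. A \<alpha>) = topspace X \<and>
     (\<forall>\<alpha> \<beta>. \<alpha> \<le> \<beta> \<longrightarrow> A \<alpha> \<subseteq> A \<beta>)"

lemma Metric_space_disk: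
  fixes smul :: "'k::real_or_complex \<Rightarrow> 'v::ab_group_add \<Rightarrow> 'v"
  assumes lcs: "locally_convex_space smul X" and B: "disk smul B" and bdd: "bounded_in smul X B"
  shows "Metric_space (module.span smul B) (\<lambda>x y. disk_norm smul B (x - y))"
proof -
  interpret vector_space smul
    using lcs by (simp add: locally_convex_space_def)
  let ?S = "\<lambda>x. {t. 0 < t \<and> x \<in> smul (of_real t) ` B}"
  let ?n = "disk_norm smul B"
  have ne: "B \<noteq> {}"
    and cv: "\<And>x y t. x \<in> B \<Longrightarrow> y \<in> B \<Longrightarrow> 0 \<le> t \<Longrightarrow> t \<le> 1 \<Longrightarrow>
      smul (of_real (1 - t)) x + smul (of_real t) y \<in> B"
    and bal: "\<And>x c. x \<in> B \<Longrightarrow> norm c \<le> 1 \<Longrightarrow> smul c x \<in> B"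
    using B by (auto simp: disk_def convex_wrt_def balanced_wrt_def)
  have SI: "t \<in> ?S x" if "0 < t" "b \<in> B" "x = smul (of_real t) b" for t x b
    using that by blast
  have SE: "\<exists>b\<in>B. x = smul (of_real t) b" if "t \<in> ?S x" for t x
    using that by blast
  have add: "s + t \<in> ?S (x + y)" if s: "s \<in> ?S x" and t: "t \<in> ?S y" for s t x y
  proof -
    obtain a b where ab: "a \<in> B" "b \<in> B" "x = smul (of_real s) a" "y = smul (of_real t) b"
      using SE[OF s] SE[OF t] by blast
    have pos: "0 < s" "0 < t" using s t by auto
    let ?c = "smul (of_real (1 - t / (s + t))) a + smul (of_real (t / (s + t))) b"
    have "?c \<in> B" using ab pos by (intro cv) auto
    moreover have "(s + t) * (1 - t / (s + t)) = s" "(s + t) * (t / (s + t)) = t"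
      using pos by (auto simp: field_simps)
    then have "smul (of_real (s + t)) ?c = x + y"
      unfolding scale_right_distrib scale_scale of_real_mult[symmetric] using ab by simp
    ultimately show ?thesis using pos by (intro SI[of _ ?c]) simp_all
  qed
  have mult: "norm c * s + e \<in> ?S (smul c x)" if s: "s \<in> ?S x" and e: "0 < e" for s e c x
  proof -
    obtain a where a: "a \<in> B" "x = smul (of_real s) a" using SE[OF s] by blast
    have pos: "0 < s" using s by auto
    let ?r = "norm c * s + e"
    have r: "0 < ?r" using pos e by (simp add: add_nonneg_pos)
    let ?b = "smul (c * of_real s / of_real ?r) a"
    have "norm (c * of_real s / of_real ?r) \<le> 1"
      using r pos e by (simp add: norm_divide norm_mult del: of_real_add of_real_mult)
    then have "?b \<in> B" using a bal by blast
    moreover have "smul (of_real ?r) ?b = smul c x"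
      using r a by (simp del: of_real_add of_real_mult)
    ultimately show ?thesis using r by (intro SI[of _ ?b]) simp_all
  qed
  have zero_in: "0 \<in> B" using ne bal[of _ 0] by auto
  have nonempty: "?S x \<noteq> {}" if "x \<in> span B" for x
    using that
  proof (induction rule: span_induct_alt)
    case base
    have "1 \<in> ?S 0" using zero_in by (intro SI[of _ 0]) simp_all
    then show ?case by blast
  next
    case (step c x y)
    from step(1) have "1 \<in> ?S x" by (intro SI[of _ x]) simp_all
    from mult[OF this, of 1 c] have 1: "norm c + 1 \<in> ?S (smul c x)" by simp
    from step(2) obtain t where "t \<in> ?S y" by blast
    from add[OF 1 this] show ?case by blast
  qed
  have bb: "bdd_below (?S x)" for x
    by (rule bdd_belowI[of _ 0]) auto
  have nn: "0 \<le> ?n x" for x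
    using nonempty[of x] by (auto simp: disk_norm_def intro!: cInf_greatest)
  have approx: "\<exists>s\<in>?S x. s < ?n x + e" if "x \<in> span B" "0 < e" for x e
  proof -
    have "Inf (?S x) < ?n x + e" using that by (simp add: disk_norm_def)
    with cInf_less_iff[OF nonempty[OF that(1)] bb] show ?thesis by auto
  qed
  have le: "?n x \<le> s" if "x \<in> span B" "s \<in> ?S x" for x s
    using cInf_lower[OF that(2) bb] that by (simp add: disk_norm_def)
  have tri: "?n (x + y) \<le> ?n x + ?n y" if x: "x \<in> span B" and y: "y \<in> span B" for x y
  proof (rule field_le_epsilon)
    fix e :: real assume e: "0 < e"
    obtain s where s: "s \<in> ?S x" "s < ?n x + e / 2" using approx[OF x, of "e / 2"] e by auto
    obtain t where t: "t \<in> ?S y" "t < ?n y + e / 2" using approx[OF y, of "e / 2"] e by auto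
    have "?n (x + y) \<le> s + t" using add[OF s(1) t(1)] x y by (intro le span_add)
    then show "?n (x + y) \<le> ?n x + ?n y + e" using s t by linarith
  qed
  have neg_eq: "?S (- x) = ?S x" for x
  proof -
    have sub: "?S x \<subseteq> ?S (- x)" for x
    proof
      fix t assume t: "t \<in> ?S x"
      obtain b where b: "b \<in> B" "x = smul (of_real t) b" using SE[OF t] by blast
      have "- b \<in> B" using bal[OF b(1), of "-1"] by simp
      then show "t \<in> ?S (- x)" using b t by (intro SI[of _ "- b"]) simp_all
    qed
    from sub[of x] sub[of "- x"] show ?thesis by (simp only: minus_minus subset_antisym)
  qed
  have sym: "?n (x - y) = ?n (y - x)" for x y
    unfolding disk_norm_def using neg_eq[of "x - y"] span_neg[of "x - y" B] span_neg[of "y - x" B]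
    by (simp only: minus_diff_eq) metis
  have null: "?n x = 0 \<longleftrightarrow> x = 0" if x: "x \<in> span B" for x
  proof
    assume x0: "x = 0"
    have "?n x \<le> e" if "0 < e" for e
    proof (rule le[OF x])
      show "e \<in> ?S x" using that zero_in by (rule SI) (simp add: x0)
    qed
    then have "?n x \<le> 0" by (rule dense_ge)
    then show "?n x = 0" using nn[of x] by (rule antisym)
  next
    assume n0: "?n x = 0"
    show "x = 0"
    proof (rule ccontr)
      assume "x \<noteq> 0"
      moreover have "Hausdorff_space X" "topspace X = UNIV"
        and cont: "continuous_map (prod_topology euclidean X) X (\<lambda>(c, x). smul c x)"
        using lcs by (auto simp: locally_convex_space_def)
      ultimately obtain U where U: "openin X U" "0 \<in> U" "x \<notin> U"
        unfolding Hausdorff_space_def disjnt_def by (metis UNIV_I disjoint_iff)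
      let ?P = "{z \<in> topspace (prod_topology euclidean X). (case z of (c, x) \<Rightarrow> smul c x) \<in> U}"
      have "openin (prod_topology euclidean X) ?P"
        using cont U(1) unfolding continuous_map_def by blast
      moreover have "(0, 0) \<in> ?P" using U \<open>topspace X = UNIV\<close> by simp
      ultimately obtain D W where DW: "openin euclidean D" "openin X W" "0 \<in> D" "0 \<in> W" "D \<times> W \<subseteq> ?P"
        unfolding openin_prod_topology_alt by meson
      then obtain d where d: "0 < d" "ball 0 d \<subseteq> D"
        by (metis open_contains_ball open_openin)
      obtain t where t: "0 < t" "B \<subseteq> smul (of_real t) ` W"
        using bdd DW unfolding bounded_in_def by meson
      obtain s where s: "s \<in> ?S x" "s < d / t"
        using approx[OF x divide_pos_pos[OF d(1) t(1)]] unfolding n0 by auto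
      obtain b where b: "b \<in> B" "x = smul (of_real s) b" using SE[OF s(1)] by blast
      from subsetD[OF t(2) b(1)] obtain w where w: "w \<in> W" "b = smul (of_real t) w"
        by (rule imageE)
      have st: "0 < s * t" "s * t < d" using s(1) t(1) s(2)[unfolded pos_less_divide_eq[OF t(1)]] by simp_all
      then have "of_real (s * t) \<in> ball (0::'k) d" unfolding mem_ball_0 norm_of_real by linarith
      with d(2) have "of_real (s * t) \<in> D" by (rule subsetD)
      then have "(of_real (s * t), w) \<in> D \<times> W" using w(1) by (rule SigmaI)
      with DW(5) have "(of_real (s * t), w) \<in> ?P" by (rule subsetD)
      then have "smul (of_real (s * t)) w \<in> U" by (simp only: mem_Collect_eq prod.case)
      moreover have "smul (of_real (s * t)) w = x" unfolding b w scale_scale of_real_mult ..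
      ultimately show False using U by simp
    qed
  qed
  show ?thesis
  proof
    fix x y z
    show "0 \<le> ?n (x - y)" by (rule nn)
    show "?n (x - y) = ?n (y - x)" by (rule sym)
    assume xy: "x \<in> span B" "y \<in> span B"
    then show "?n (x - y) = 0 \<longleftrightarrow> x = y" using null[of "x - y"] by (simp add: span_diff)
    assume z: "z \<in> span B"
    have "?n ((x - y) + (y - z)) \<le> ?n (x - y) + ?n (y - z)"
      using xy z by (intro tri span_diff)
    then show "?n (x - z) \<le> ?n (x - y) + ?n (y - z)" by simp
  qed
qed


section \<open>Test functions and distributions\<close>

definition pscale :: "'k::times \<Rightarrow> ('x \<Rightarrow> 'k) \<Rightarrow> 'x \<Rightarrow> 'k" where
  "pscale c f = (\<lambda>x. c * f x)"

lemma vector_space_pscale: "vector_space (pscale :: 'k::field \<Rightarrow> ('x \<Rightarrow> 'k) \<Rightarrow> 'x \<Rightarrow> 'k)"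
  by standard (simp_all add: pscale_def fun_eq_iff algebra_simps)

definition partial_derivative ::
  "'d::finite \<Rightarrow> (real^'d \<Rightarrow> 'k::real_or_complex) \<Rightarrow> real^'d \<Rightarrow> 'k" where
  "partial_derivative i f x = frechet_derivative f (at x) (axis i 1)"

definition partials :: "'d::finite list \<Rightarrow> (real^'d \<Rightarrow> 'k::real_or_complex) \<Rightarrow> real^'d \<Rightarrow> 'k" where
  "partials is f = foldr partial_derivative is f"

definition smooth :: "(real^'d::finite \<Rightarrow> 'k::real_or_complex) \<Rightarrow> bool" where
  "smooth f \<longleftrightarrow> (\<forall>is. partials is f differentiable_on UNIV)"

definition supp :: "(real^'d::finite \<Rightarrow> 'k::real_or_complex) \<Rightarrow> (real^'d) set" where
  "supp f = closure {x. f x \<noteq> 0}"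

text \<open>Test functions on an open set are represented by their extensions by zero.\<close>

definition test_functions :: "(real^'d::finite) set \<Rightarrow> (real^'d \<Rightarrow> 'k::real_or_complex) set" where
  "test_functions \<Omega> = {f. smooth f \<and> compact (supp f) \<and> supp f \<subseteq> \<Omega>}"

text \<open>For compact \<open>K\<close>, the Frechet space of test functions supported in \<open>K\<close>.\<close>

definition frechet_topology ::
  "(real^'d::finite) set \<Rightarrow> (real^'d \<Rightarrow> 'k::real_or_complex) topology" where
  "frechet_topology K =
     seminorm_topology (test_functions K) (range (\<lambda>is f. SUP x. norm (partials is f x)))"

text \<open>The locally convex inductive limit of these Frechet spaces: its defining seminorms
  are all those whose restrictions to the steps are continuous.\<close>

definition test_topology ::
  "(real^'d::finite) set \<Rightarrow> (real^'d \<Rightarrow> 'k::real_or_complex) topology" where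
  "test_topology \<Omega> = seminorm_topology (test_functions \<Omega>)
     {p. seminorm_on pscale (test_functions \<Omega>) p \<and>
         (\<forall>K. compact K \<and> K \<subseteq> \<Omega> \<longrightarrow> continuous_map (frechet_topology K) euclideanreal p)}"

type_synonym ('k, 'd) functional = "(real^'d \<Rightarrow> 'k) \<Rightarrow> 'k"

text \<open>Distributions are made extensional, by the value 0 off the test functions, so that
  equality of functionals is equality of distributions.\<close>

definition distributions ::
  "(real^'d::finite) set \<Rightarrow> ('k::real_or_complex, 'd) functional set" where
  "distributions \<Omega> = {u.
     linear_map_on pscale (*) (test_functions \<Omega>) u \<and>
     continuous_map (test_topology \<Omega>) euclidean u \<and>
     (\<forall>f. f \<notin> test_functions \<Omega> \<longrightarrow> u f = 0)}"


section \<open>Wavefront sets and the normal topology\<close>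

text \<open>
  The Fourier transform of the product of \<open>u\<close> and \<open>\<phi>\<close> at \<open>\<xi>\<close> is
  \<open>\<langle>u, \<phi> e\<^sub>\<xi>\<rangle>\<close> with \<open>e\<^sub>\<xi> x = exp (- \<i> (x \<bullet> \<xi>))\<close>. The exponential is split into real and imaginary
  part, so that the formula also applies to real distributions.
\<close>

definition fourier_localized ::
  "('k::real_or_complex, 'd::finite) functional \<Rightarrow> (real^'d \<Rightarrow> 'k) \<Rightarrow> real^'d \<Rightarrow> complex" where
  "fourier_localized u \<phi> \<xi> =
     cplx (u (\<lambda>x. \<phi> x * of_real (cos (x \<bullet> \<xi>)))) - \<i> * cplx (u (\<lambda>x. \<phi> x * of_real (sin (x \<bullet> \<xi>))))"

definition wavefront_set ::
  "(real^'d::finite) set \<Rightarrow> ('k::real_or_complex, 'd) functional \<Rightarrow> ((real^'d) \<times> (real^'d)) set" where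
  "wavefront_set \<Omega> u = {(x, \<xi>). x \<in> \<Omega> \<and> \<xi> \<noteq> 0 \<and>
     \<not> (\<exists>\<phi>\<in>test_functions \<Omega>. \<exists>V. \<phi> x \<noteq> 0 \<and> cone V \<and> \<xi> \<in> interior V \<and>
          (\<forall>N::nat. \<exists>C. \<forall>\<eta>\<in>V. (1 + norm \<eta>) ^ N * norm (fourier_localized u \<phi> \<eta>) \<le> C))}"

definition closed_cone_over :: "(real^'d::finite) set \<Rightarrow> ((real^'d) \<times> (real^'d)) set \<Rightarrow> bool" where
  "closed_cone_over \<Omega> \<Gamma> \<longleftrightarrow>
     closedin (top_of_set (\<Omega> \<times> (UNIV - {0}))) \<Gamma> \<and>
     (\<forall>x \<xi> t. (x, \<xi>) \<in> \<Gamma> \<and> 0 < t \<longrightarrow> (x, t *\<^sub>R \<xi>) \<in> \<Gamma>)"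

definition distributions_WF ::
  "(real^'d::finite) set \<Rightarrow> ((real^'d) \<times> (real^'d)) set \<Rightarrow> ('k::real_or_complex, 'd) functional set" where
  "distributions_WF \<Omega> \<Gamma> = {u \<in> distributions \<Omega>. wavefront_set \<Omega> u \<subseteq> \<Gamma>}"

definition seminorm_bounded ::
  "(real^'d::finite \<Rightarrow> 'k::real_or_complex) set \<Rightarrow> ('k, 'd) functional \<Rightarrow> real" where
  "seminorm_bounded B u = (SUP f\<in>B. norm (u f))"

definition seminorm_WF ::
  "nat \<Rightarrow> (real^'d::finite) set \<Rightarrow> (real^'d \<Rightarrow> 'k::real_or_complex) \<Rightarrow> ('k, 'd) functional \<Rightarrow> real" where
  "seminorm_WF N V \<phi> u = (SUP \<xi>\<in>V. (1 + norm \<xi>) ^ N * norm (fourier_localized u \<phi> \<xi>))"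

text \<open>Empty index sets are left out because the real supremum of the empty set is unspecified.
  All other suprema are finite on \<open>distributions_WF \<Omega> \<Gamma>\<close>.\<close>

definition normal_topology ::
  "(real^'d::finite) set \<Rightarrow> ((real^'d) \<times> (real^'d)) set \<Rightarrow> ('k::real_or_complex, 'd) functional topology" where
  "normal_topology \<Omega> \<Gamma> = seminorm_topology (distributions_WF \<Omega> \<Gamma>)
     ({seminorm_bounded B |B. B \<noteq> {} \<and> bounded_in pscale (test_topology \<Omega>) B} \<union>
      {seminorm_WF N V \<phi> |N V \<phi>. \<phi> \<in> test_functions \<Omega> \<and> V \<noteq> {} \<and> closed V \<and> cone V \<and>
         (supp \<phi> \<times> V) \<inter> \<Gamma> = {}})"


text \<open>\<open>image_union A H T r k\<close> is the set \<open>V\<close> with index \<open>r 0, \<dots>, r (k - 1)\<close>; positions in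
  sequences of natural numbers are counted from 0.\<close>

definition image_union ::
  "((nat \<Rightarrow> nat) \<Rightarrow> 'v set) \<Rightarrow> 'v set \<Rightarrow> ('v \<Rightarrow> 'w) \<Rightarrow> (nat \<Rightarrow> nat) \<Rightarrow> nat \<Rightarrow> 'w set" where
  "image_union A H T r k = \<Union> {T ` (A \<alpha> \<inter> H) |\<alpha>. \<forall>n<k. \<alpha> n = r n}"

end

theory Submission
  imports Defs
begin

text \<open>
  The sets \<open>V\<^sub>k\<close> of the hypothesis drive the usual open mapping iteration: if \<open>\<rho>\<close> lies in the
  closure of \<open>2\<^sup>-\<^sup>k V\<^sub>k\<close>, some \<open>x \<in> 2\<^sup>-\<^sup>k A\<^sub>\<alpha> \<inter> H\<close>, with \<open>\<alpha>\<close> equal to \<open>r\<close> below \<open>k\<close>, brings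
  \<open>\<rho> - T x\<close> into the closure of \<open>2\<^sup>-\<^sup>k\<^sup>-\<^sup>1 V\<^sub>k\<^sub>+\<^sub>1\<close>. Since the indices \<open>\<alpha>\<close> agree with \<open>r\<close> on longer
  and longer segments, they have a common upper bound \<open>\<beta>\<close>, so the series of the \<open>x\<close> converges in
  the Banach space spanned by \<open>A \<beta>\<close>. The target is not metrizable and the residuals are not known
  to tend to 0, but the closed graph alone identifies the image of the sum: a residual is
  approximated by some \<open>T a\<close> with \<open>a \<in> 2\<^sup>-\<^sup>k A\<^sub>\<alpha>\<close>, and adding such \<open>a\<close> to the partial sums does
  not change their limit. For a null sequence the iteration for \<open>y n\<close> starts at a stage tending to
  infinity with \<open>n\<close>, and one \<open>\<beta>\<close> serves all \<open>n\<close>.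
\<close>

section \<open>Disks\<close>

lemma
  fixes smul :: "'k::real_or_complex \<Rightarrow> 'v::ab_group_add \<Rightarrow> 'v"
  assumes "vector_space smul" and "0 < t" and "x \<in> smul (of_real t) ` B"
  shows scaled_in_span: "x \<in> module.span smul B"
    and disk_norm_le: "disk_norm smul B x \<le> t"
proof -
  interpret vector_space smul by fact
  show *: "x \<in> span B"
    using assms by (auto intro: span_scale span_base)
  have "bdd_below {t. 0 < t \<and> x \<in> smul (of_real t) ` B}"
    by (rule bdd_belowI[of _ 0]) auto
  then show "disk_norm smul B x \<le> t"
    using assms * by (auto simp: disk_norm_def intro!: cInf_lower)
qed

lemma disk_zero:
  fixes smul :: "'k::real_or_complex \<Rightarrow> 'v::ab_group_add \<Rightarrow> 'v"
  assumes "vector_space smul" and "disk smul B"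
  shows "0 \<in> B"
proof -
  interpret vector_space smul by fact
  obtain b where "b \<in> B" using assms by (auto simp: disk_def)
  then have "smul 0 b \<in> B"
    using assms by (auto simp: disk_def balanced_wrt_def simp del: scale_zero_left)
  then show ?thesis by simp
qed

text \<open>Convexity puts s B + t B inside (s + t) B, with weights s/(s + t) and t/(s + t), and
  balancedness absorbs the scalars. Hence on the span the infimum in \<open>disk_norm\<close> is
  over a nonempty set.\<close>

lemma disk_absorbs:
  fixes smul :: "'k::real_or_complex \<Rightarrow> 'v::ab_group_add \<Rightarrow> 'v"
  assumes "vector_space smul" and B: "disk smul B" and "x \<in> module.span smul B"
  shows "\<exists>t>0. x \<in> smul (of_real t) ` B"
proof -
  interpret vector_space smul by fact
  have cv: "\<And>x y t. x \<in> B \<Longrightarrow> y \<in> B \<Longrightarrow> 0 \<le> t \<Longrightarrow> t \<le> 1 \<Longrightarrow>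
      smul (of_real (1 - t)) x + smul (of_real t) y \<in> B"
    and bal: "\<And>x c. x \<in> B \<Longrightarrow> norm c \<le> 1 \<Longrightarrow> smul c x \<in> B"
    using B by (auto simp: disk_def convex_wrt_def balanced_wrt_def)
  show ?thesis
    using assms(3)
  proof (induction rule: span_induct_alt)
    case base
    have "0 \<in> smul (of_real 1) ` B"
      using disk_zero[OF assms(1,2)] by force
    then show ?case
      using zero_less_one by blast
  next
    case (step c x y)
    then obtain t b where t: "0 < t" "b \<in> B" "y = smul (of_real t) b" by blast
    define s where "s = norm c + 1"
    have s: "0 < s" "norm c \<le> s" by (auto simp: s_def add_nonneg_pos)
    define a where "a = smul (c / of_real s) x"
    have a: "a \<in> B"
      unfolding a_def using s by (intro bal step) (simp add: norm_divide)
    let ?z = "smul (of_real (1 - t / (s + t))) a + smul (of_real (t / (s + t))) b"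
    have "?z \<in> B" using a t s by (intro cv) auto
    moreover have e: "(s + t) * (1 - t / (s + t)) = s" "(s + t) * (t / (s + t)) = t"
      using s t by (auto simp: field_simps)
    then have "smul (of_real (s + t)) ?z = smul (of_real s) a + smul (of_real t) b"
      unfolding scale_right_distrib scale_scale of_real_mult[symmetric] by simp
    then have "smul (of_real (s + t)) ?z = smul c x + y"
      using s t by (simp add: a_def)
    ultimately show ?case
      using s t by (intro exI[of _ "s + t"]) (metis add_pos_pos image_eqI)
  qed
qed

text \<open>The infimum need not be attained, which is why the inequality is strict: some s < t
  already has x in s B, and balancedness enlarges s to t.\<close>

lemma disk_norm_less:
  fixes smul :: "'k::real_or_complex \<Rightarrow> 'v::ab_group_add \<Rightarrow> 'v"
  assumes "vector_space smul" and B: "disk smul B"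
    and x: "x \<in> module.span smul B" and less: "disk_norm smul B x < t"
  shows "x \<in> smul (of_real t) ` B"
proof -
  interpret vector_space smul by fact
  have "{t. 0 < t \<and> x \<in> smul (of_real t) ` B} \<noteq> {}"
    using disk_absorbs[OF assms(1-3)] by blast
  moreover have "Inf {t. 0 < t \<and> x \<in> smul (of_real t) ` B} < t"
    using less x by (simp add: disk_norm_def)
  ultimately have "\<exists>s\<in>{t. 0 < t \<and> x \<in> smul (of_real t) ` B}. s < t"
    by (rule cInf_lessD)
  then obtain s b where s: "0 < s" "s < t" "b \<in> B" "x = smul (of_real s) b"
    by blast
  have "norm (of_real (s / t) :: 'k) \<le> 1" using s unfolding norm_of_real by simp
  then have "smul (of_real (s / t)) b \<in> B"
    using B s(3) unfolding disk_def balanced_wrt_def by blast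
  moreover have "x = smul (of_real t) (smul (of_real (s / t)) b)"
    using s by simp
  ultimately show ?thesis by blast
qed

lemma disk_norm_triangle:
  fixes smul :: "'k::real_or_complex \<Rightarrow> 'v::ab_group_add \<Rightarrow> 'v"
  assumes "locally_convex_space smul X" and "disk smul B" and "bounded_in smul X B"
    and x: "x \<in> module.span smul B" and y: "y \<in> module.span smul B"
  shows "disk_norm smul B (x + y) \<le> disk_norm smul B x + disk_norm smul B y"
proof -
  interpret vector_space smul
    using assms by (simp add: locally_convex_space_def)
  interpret M: Metric_space "span B" "\<lambda>x y. disk_norm smul B (x - y)"
    using assms(1-3) by (rule Metric_space_disk)
  show ?thesis
    using M.triangle[of x 0 "- y"] x y span_neg span_zero by simp
qed

text \<open>By continuity of scalar multiplication at (0, 0), D W lies in a given neighborhood of 0.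
  Boundedness puts \<open>B\<close> into t W, and s i * t is eventually in D.\<close>

lemma limitin_scaled_bounded:
  fixes smul :: "'k::real_or_complex \<Rightarrow> 'v::ab_group_add \<Rightarrow> 'v"
  assumes lcs: "locally_convex_space smul X" and bdd: "bounded_in smul X B"
    and s: "s \<longlonglongrightarrow> 0" and z: "\<And>i. z i \<in> smul (of_real (s i)) ` B"
  shows "limitin X z 0 sequentially"
  unfolding limitin_def
proof (intro conjI allI impI)
  interpret vector_space smul
    using lcs by (simp add: locally_convex_space_def)
  have top: "topspace X = UNIV"
    and cont: "continuous_map (prod_topology euclidean X) X (\<lambda>(c, x). smul c x)"
    using lcs by (auto simp: locally_convex_space_def)
  show "0 \<in> topspace X" by (simp add: top)
  fix U assume U: "openin X U \<and> 0 \<in> U"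
  let ?P = "{p \<in> topspace (prod_topology euclidean X). (case p of (c, x) \<Rightarrow> smul c x) \<in> U}"
  have "openin (prod_topology euclidean X) ?P"
    using cont U unfolding continuous_map_def by blast
  moreover have "(0, 0) \<in> ?P" using U top by simp
  ultimately obtain D W where DW: "openin euclidean D" "openin X W" "0 \<in> D" "0 \<in> W" "D \<times> W \<subseteq> ?P"
    unfolding openin_prod_topology_alt by meson
  obtain t where t: "0 < t" "B \<subseteq> smul (of_real t) ` W"
    using bdd DW unfolding bounded_in_def by meson
  have "(\<lambda>i. of_real (s i * t) :: 'k) \<longlonglongrightarrow> of_real (0 * t)"
    by (intro tendsto_intros s)
  then have "\<forall>\<^sub>F i in sequentially. (of_real (s i * t) :: 'k) \<in> D"
    using DW by (intro topological_tendstoD[where l = 0]) auto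
  then show "\<forall>\<^sub>F i in sequentially. z i \<in> U"
  proof eventually_elim
    case (elim i)
    obtain w where "w \<in> W" "z i = smul (of_real (s i * t)) w"
      using z[of i] t(2) by fastforce
    then show ?case
      using elim DW(5) by auto
  qed
qed

lemma limitin_add:
  fixes smul :: "'k::real_or_complex \<Rightarrow> 'v::ab_group_add \<Rightarrow> 'v"
  assumes lcs: "locally_convex_space smul X"
    and "limitin X x l F" and "limitin X z m F"
  shows "limitin X (\<lambda>i. x i + z i) (l + m) F"
proof -
  have "continuous_map (prod_topology X X) X (\<lambda>(x, y). x + y)"
    using lcs by (simp add: locally_convex_space_def)
  moreover have "limitin (prod_topology X X) (\<lambda>i. (x i, z i)) (l, m) F"
    using assms by (simp add: limitin_pairwise o_def)
  ultimately show ?thesis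
    by (auto dest: continuous_map_limit simp: o_def)
qed

lemma limitin_disk_metric_iff:
  fixes smul :: "'k::real_or_complex \<Rightarrow> 'v::ab_group_add \<Rightarrow> 'v"
  assumes "locally_convex_space smul X" and "disk smul B" and "bounded_in smul X B"
    and x: "\<And>i. x i \<in> module.span smul B"
  shows "limitin (mtopology_of (disk_metric smul B)) x l sequentially \<longleftrightarrow>
     l \<in> module.span smul B \<and> (\<lambda>i. disk_norm smul B (x i - l)) \<longlonglongrightarrow> 0"
proof -
  interpret M: Metric_space "module.span smul B" "\<lambda>x y. disk_norm smul B (x - y)"
    using assms(1-3) by (rule Metric_space_disk)
  show ?thesis
    using x by (simp add: disk_metric_def M.mtopology_of M.limitin_metric_dist_null)
qed

text \<open>Boundedness of \<open>B\<close> makes the inclusion of the normed space spanned by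
  \<open>B\<close> into \<open>X\<close> continuous.\<close>

lemma limitin_disk_metric_imp:
  fixes smul :: "'k::real_or_complex \<Rightarrow> 'v::ab_group_add \<Rightarrow> 'v"
  assumes lcs: "locally_convex_space smul X" and B: "disk smul B" and bdd: "bounded_in smul X B"
    and x: "\<And>i. x i \<in> module.span smul B"
    and lim: "limitin (mtopology_of (disk_metric smul B)) x l sequentially"
  shows "limitin X x l sequentially"
proof -
  interpret vector_space smul
    using lcs by (simp add: locally_convex_space_def)
  have l: "l \<in> span B" and n: "(\<lambda>i. disk_norm smul B (x i - l)) \<longlonglongrightarrow> 0"
    using lim limitin_disk_metric_iff[OF lcs B bdd x] by auto
  \<comment> \<open>The positive second summand makes the factor exceed the norm strictly, as
    \<open>disk_norm_less\<close> requires.\<close>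
  let ?s = "\<lambda>i. disk_norm smul B (x i - l) + inverse (real (Suc i))"
  have "?s \<longlonglongrightarrow> 0"
    using tendsto_add[OF n LIMSEQ_inverse_real_of_nat] by simp
  moreover have "x i - l \<in> smul (of_real (?s i)) ` B" for i
    using x l by (intro disk_norm_less vector_space_axioms B span_diff) auto
  ultimately have "limitin X (\<lambda>i. x i - l) 0 sequentially"
    by (rule limitin_scaled_bounded[OF lcs bdd])
  moreover have "limitin X (\<lambda>i. l) l sequentially"
    using lcs by (simp add: locally_convex_space_def)
  ultimately show ?thesis
    using limitin_add[OF lcs] by fastforce
qed

text \<open>The number \<open>k\<close> of vanishing leading terms enters the norm bound. In the
  lifting it is the starting stage of the iteration, so that the sums themselves tend to 0.\<close>

lemma banach_disk_geometric_series:
  fixes smul :: "'k::real_or_complex \<Rightarrow> 'v::ab_group_add \<Rightarrow> 'v"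
  assumes lcs: "locally_convex_space smul X" and B: "banach_disk smul X B"
    and x: "\<And>j. x j \<in> smul (of_real ((1/2) ^ j)) ` B" and x0: "\<And>j. j < k \<Longrightarrow> x j = 0"
  obtains u where "u \<in> module.span smul B"
    and "limitin (mtopology_of (disk_metric smul B)) (\<lambda>i. \<Sum>j<i. x j) u sequentially"
    and "disk_norm smul B u \<le> 2 * (1/2) ^ k"
proof -
  interpret vector_space smul
    using lcs by (simp add: locally_convex_space_def)
  have d: "disk smul B" and bdd: "bounded_in smul X B"
    using B by (auto simp: banach_disk_def)
  interpret M: Metric_space "span B" "\<lambda>x y. disk_norm smul B (x - y)"
    using lcs d bdd by (rule Metric_space_disk)
  note tri = disk_norm_triangle[OF lcs d bdd]
  let ?S = "\<lambda>i. \<Sum>j<i. x j"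
  have xs: "x j \<in> span B" "disk_norm smul B (x j) \<le> (1/2) ^ j" for j
    using scaled_in_span[OF vector_space_axioms _ x] disk_norm_le[OF vector_space_axioms _ x]
    by simp_all
  have Ss: "?S i \<in> span B" for i
    by (intro span_sum xs)
  \<comment> \<open>The subtracted term closes the induction exactly: from l to l + 1 the bound
    grows by (1/2)^l, the bound on the norm of \<open>x l\<close>.\<close>
  have tail: "disk_norm smul B (?S l - ?S i) \<le> 2 * (1/2) ^ i - 2 * (1/2) ^ l" if "i \<le> l" for i l
    using that
  proof (induction l rule: dec_induct)
    case base
    then show ?case using M.mdist_zero[of 0] span_zero by simp
  next
    case (step l)
    have "disk_norm smul B ((?S l - ?S i) + x l) \<le> disk_norm smul B (?S l - ?S i) + disk_norm smul B (x l)"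
      by (intro tri span_diff Ss xs)
    then show ?case
      using step xs(2)[of l] by (simp add: algebra_simps)
  qed
  have tail': "disk_norm smul B (?S l - ?S i) \<le> 2 * (1/2) ^ i" if "i \<le> l" for i l
    using tail[OF that] by (rule order_trans) simp
  have half: "(\<lambda>i. 2 * (1/2) ^ i :: real) \<longlonglongrightarrow> 0"
    by (intro tendsto_mult_right_zero LIMSEQ_power_zero) simp
  have "M.MCauchy ?S"
    unfolding M.MCauchy_def
  proof (intro conjI allI impI)
    show "range ?S \<subseteq> span B" using Ss by blast
    fix e :: real assume "0 < e"
    then obtain N where N: "2 * (1/2) ^ N < e"
      using order_tendstoD(2)[OF half] by (auto simp: eventually_sequentially)
    have "disk_norm smul B (?S l - ?S i) < e" if "N \<le> i" "i \<le> l" for i l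
    proof -
      have "(1/2) ^ i \<le> (1/2 :: real) ^ N" using that by (simp add: power_decreasing)
      then show ?thesis using tail'[OF that(2)] N by linarith
    qed
    then show "\<exists>N. \<forall>i i'. N \<le> i \<longrightarrow> N \<le> i' \<longrightarrow> disk_norm smul B (?S i - ?S i') < e"
      by (metis M.commute nat_le_linear)
  qed
  moreover have "M.mcomplete"
    using B by (simp add: banach_disk_def disk_metric_def)
  ultimately obtain u where lim: "limitin M.mtopology ?S u sequentially"
    unfolding M.mcomplete_def by blast
  then have lim': "limitin (mtopology_of (disk_metric smul B)) ?S u sequentially"
    by (simp add: disk_metric_def M.mtopology_of)
  then have u: "u \<in> span B" and null: "(\<lambda>i. disk_norm smul B (?S i - u)) \<longlonglongrightarrow> 0"
    using limitin_disk_metric_iff[OF lcs d bdd Ss] by auto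
  \<comment> \<open>Since the partial sum at \<open>k\<close> vanishes, the tail bound from
    \<open>k\<close> on bounds every later partial sum.\<close>
  have Sk: "?S k = 0" using x0 by simp
  have "\<forall>i\<ge>k. disk_norm smul B u \<le> disk_norm smul B (?S i - u) + 2 * (1/2) ^ k"
  proof (intro allI impI)
    fix i assume "k \<le> i"
    have "disk_norm smul B ((u - ?S i) + ?S i) \<le> disk_norm smul B (u - ?S i) + disk_norm smul B (?S i)"
      by (intro tri span_diff Ss u)
    moreover have "disk_norm smul B (?S i) \<le> 2 * (1/2) ^ k"
      using tail'[OF \<open>k \<le> i\<close>] unfolding Sk by simp
    ultimately show "disk_norm smul B u \<le> disk_norm smul B (?S i - u) + 2 * (1/2) ^ k"
      using M.commute[of u "?S i"] by simp
  qed
  then have "disk_norm smul B u \<le> 0 + 2 * (1/2) ^ k"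
    by (intro LIMSEQ_le_const[OF tendsto_add[OF null tendsto_const]]) auto
  then show thesis using that u lim' by simp
qed

lemma pointwise_bounded_upper_bound:
  fixes \<alpha> :: "'i \<Rightarrow> nat \<Rightarrow> nat"
  assumes "\<And>p. finite ((\<lambda>i. \<alpha> i p) ` I)"
  shows "\<exists>\<beta>. \<forall>i\<in>I. \<alpha> i \<le> \<beta>"
proof (intro exI ballI)
  fix i assume "i \<in> I"
  then show "\<alpha> i \<le> (\<lambda>p. Max ((\<lambda>i. \<alpha> i p) ` I))"
    using assms by (auto simp: le_fun_def)
qed

section \<open>Lifting null sequences\<close>

lemma linear_map_on_image_subspace:
  assumes "vector_space smul" and "vector_space smul'"
    and H: "module.subspace smul H" and T: "linear_map_on smul smul' H T"
  shows "module.subspace smul' (T ` H)"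
proof -
  interpret vector_space smul by fact
  interpret E: vector_space smul' by fact
  have add: "T x + T z = T (x + z)" if "x \<in> H" "z \<in> H" for x z
    using T that by (auto simp: linear_map_on_def)
  have scale: "smul' c (T x) = T (smul c x)" if "x \<in> H" for c x
    using T that by (auto simp: linear_map_on_def)
  have T0: "T 0 = 0"
    using scale[OF subspace_0[OF H], of 0] by simp
  show ?thesis
    unfolding E.subspace_def
  proof (intro conjI allI ballI)
    show "0 \<in> T ` H"
      using subspace_0[OF H] T0[symmetric] by (rule rev_image_eqI)
    show "x + z \<in> T ` H" if "x \<in> T ` H" "z \<in> T ` H" for x z
      using that subspace_add[OF H] by (auto simp: add)
    show "smul' c x \<in> T ` H" if "x \<in> T ` H" for c x
      using that subspace_scale[OF H] by (auto simp: scale)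
  qed
qed

text \<open>The assumption \<open>affine\<close> is weaker than \<open>E\<close> being a topological vector space. For the normal
  topology it holds even without knowing that the defining suprema are finite.\<close>

theorem fast_convergent_lifting:
  fixes smul :: "'k::real_or_complex \<Rightarrow> 'f::ab_group_add \<Rightarrow> 'f"
    and smul' :: "'k \<Rightarrow> 'e::ab_group_add \<Rightarrow> 'e"
  assumes lcs: "locally_convex_space smul F"
    and A: "quasi_LB_representation smul F A"
    and H: "fast_closed smul F H"
    and vs': "vector_space smul'"
    and T: "linear_map_on smul smul' H T"
    and top: "topspace E = T ` H"
    and affine: "\<And>U a c. openin E U \<Longrightarrow> a \<in> T ` H \<Longrightarrow> c \<noteq> 0 \<Longrightarrow>
      openin E {z \<in> T ` H. a + smul' c z \<in> U}"
    and graph: "closedin (prod_topology (subtopology F H) E) {(x, T x) |x. x \<in> H}"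
    and V: "\<And>k. k \<ge> 1 \<Longrightarrow> 0 \<in> E interior_of (E closure_of image_union A H T r k)"
    and y: "limitin E y 0 sequentially" and y_in: "\<And>n. y n \<in> T ` H"
  shows "\<exists>\<beta> u. (\<forall>n. u n \<in> module.span smul (A \<beta>) \<inter> H) \<and>
           fast_convergent smul F u \<and> (\<forall>n. T (u n) = y n)"
proof -
  interpret vector_space smul
    using lcs by (simp add: locally_convex_space_def)
  interpret E: vector_space smul' by fact
  have topF: "topspace F = UNIV"
    using lcs by (simp add: locally_convex_space_def)
  have bd: "banach_disk smul F (A \<alpha>)" and AF: "(\<Union>\<alpha>. A \<alpha>) = UNIV"
    and mono: "\<alpha> \<le> \<beta> \<Longrightarrow> A \<alpha> \<subseteq> A \<beta>" for \<alpha> \<beta>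
    using A topF by (auto simp: quasi_LB_representation_def)
  have dA: "disk smul (A \<alpha>)" and bA: "bounded_in smul F (A \<alpha>)" for \<alpha>
    using bd by (auto simp: banach_disk_def)
  have subH: "subspace H"
    and clH: "\<And>B. banach_disk smul F B \<Longrightarrow>
      closedin (mtopology_of (disk_metric smul B)) (H \<inter> span B)"
    using H by (auto simp: fast_closed_def)
  have Tadd: "T (x + z) = T x + T z" if "x \<in> H" "z \<in> H" for x z
    using T that by (auto simp: linear_map_on_def)
  have Tscale: "T (smul c x) = smul' c (T x)" if "x \<in> H" for c x
    using T that by (auto simp: linear_map_on_def)
  have H0: "0 \<in> H" using subH by (rule subspace_0)
  have T0: "T 0 = 0" using Tscale[OF H0, of 0] by simp
  have subE: "E.subspace (T ` H)"
    by (rule linear_map_on_image_subspace[OF vector_space_axioms vs' subH T])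

  \<comment> \<open>Dilates of the closures of the sets \<open>?V k\<close>\<close>
  let ?V = "image_union A H T r"
  \<comment> \<open>\<open>D k\<close> is 2^-k times the closure of \<open>?V k\<close>, and
    \<open>I k\<close> is the same for its interior. Written as preimages under multiplication by
    2^k, they get the openness of \<open>I k\<close> from \<open>affine\<close>.\<close>
  define I where "I k = {z \<in> T ` H. smul' (2 ^ k) z \<in> E interior_of (E closure_of ?V k)}" for k
  define D where "D k = {z \<in> T ` H. smul' (2 ^ k) z \<in> E closure_of ?V k}" for k
  \<comment> \<open>Stage 0 fixes no coordinate of the index, so \<open>?V 0\<close> is the whole
    target. Thus \<open>D 0\<close> contains every point, and each \<open>y n\<close> has an
    admissible starting stage.\<close>
  have V0: "?V 0 = topspace E"
    unfolding top image_union_def using AF by blast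
  have V': "0 \<in> E interior_of (E closure_of ?V k)" for k
  proof (cases "k = 0")
    case True
    have "E interior_of (E closure_of ?V k) = topspace E"
      unfolding True V0 by simp
    then show ?thesis using E.subspace_0[OF subE] top by simp
  next
    case False
    then show ?thesis using V[of k] by simp
  qed
  have I_open: "openin E (I k)" for k
    using affine[of "E interior_of (E closure_of ?V k)" 0 "2 ^ k"] E.subspace_0[OF subE]
    by (simp add: I_def)
  have I0: "0 \<in> I k" for k
    using V' E.subspace_0[OF subE] by (simp add: I_def)
  have ID: "I k \<subseteq> D k" for k
    using interior_of_subset unfolding I_def D_def by fast
  have D0: "D 0 = T ` H"
  proof -
    have "E closure_of ?V 0 = T ` H"
      unfolding V0 closure_of_topspace by (rule top)
    then show ?thesis by (auto simp: D_def)
  qed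

  \<comment> \<open>The preimage of \<open>U\<close> under the rescaled affine map is open and
    contains 2^k z, a point of the closure of \<open>?V k\<close>, so it meets \<open>?V k\<close>.
    This is used with c = -1 to improve a residual and with c = 1 for the closed graph.\<close>
  have meet: "\<exists>x \<alpha>. x \<in> H \<and> x \<in> smul (of_real ((1/2) ^ k)) ` A \<alpha> \<and> (\<forall>n<k. \<alpha> n = r n) \<and> a + smul' c (T x) \<in> U"
    if U: "openin E U" and a: "a \<in> T ` H" and c: "c \<noteq> 0" and z: "z \<in> D k" and aU: "a + smul' c z \<in> U"
    for k a c z U
  proof -
    let ?W = "{v \<in> T ` H. a + smul' (c / 2 ^ k) v \<in> U}"
    have W: "openin E ?W"
      by (rule affine[OF U a]) (simp add: c)
    have zW: "smul' (2 ^ k) z \<in> ?W"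
      using z aU E.subspace_scale[OF subE, of z "2 ^ k"] by (simp add: D_def)
    have "smul' (2 ^ k) z \<in> E closure_of ?V k"
      using z by (simp add: D_def)
    then have "\<exists>v. v \<in> ?V k \<and> v \<in> ?W"
      unfolding in_closure_of by (elim conjE allE[of _ ?W]) (rule mp, assumption, rule conjI[OF zW W])
    then obtain v \<alpha> where "v \<in> T ` (A \<alpha> \<inter> H)" and \<alpha>: "\<forall>n<k. \<alpha> n = r n"
      and v: "a + smul' (c / 2 ^ k) v \<in> U"
      by (auto simp only: image_union_def Union_iff mem_Collect_eq)
    then obtain b where b: "b \<in> A \<alpha>" "b \<in> H" "v = T b"
      by blast
    let ?x = "smul (of_real ((1/2) ^ k)) b"
    have "smul' c (T ?x) = smul' (c / 2 ^ k) (T b)"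
      unfolding Tscale[OF b(2)] E.scale_scale by (simp add: power_one_over)
    then have "a + smul' c (T ?x) \<in> U"
      using v b(3) by (simp only:)
    moreover have "?x \<in> H"
      using b(2) by (rule subspace_scale[OF subH])
    ultimately show ?thesis
      using b(1) \<alpha> by blast
  qed

  have step: "\<exists>x \<alpha>. x \<in> H \<and> x \<in> smul (of_real ((1/2) ^ k)) ` A \<alpha> \<and> (\<forall>n<k. \<alpha> n = r n) \<and> z - T x \<in> D (Suc k)"
    if z: "z \<in> D k" for k z
  proof -
    have "z \<in> T ` H" using z by (simp add: D_def)
    \<comment> \<open>With a = z and c = -1 the affine map sends z to 0, which lies in the open set
      \<open>I (Suc k)\<close>.\<close>
    moreover have "z + smul' (- 1) z \<in> I (Suc k)" using I0 by simp
    ultimately obtain x \<alpha> where "x \<in> H" "x \<in> smul (of_real ((1/2) ^ k)) ` A \<alpha>" "\<forall>n<k. \<alpha> n = r n"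
        "z + smul' (- 1) (T x) \<in> I (Suc k)"
      using meet[OF I_open, of z "- 1" z k "Suc k"] z by auto
    then show ?thesis
      using ID[of "Suc k"] by (intro exI[of _ x] exI[of _ \<alpha>]) auto
  qed

  \<comment> \<open>Starting stages tending to infinity\<close>
  define K where "K n = Max {k. k \<le> n \<and> y n \<in> D k}" for n
  \<comment> \<open>The maximum is attained: the cap k \<le> n keeps the set finite, and
    \<open>D 0\<close> keeps it nonempty.\<close>
  have K: "y n \<in> D (K n)" for n
  proof -
    have "K n \<in> {k. k \<le> n \<and> y n \<in> D k}"
      unfolding K_def using y_in D0 by (intro Max_in) auto
    then show ?thesis by simp
  qed
  have K_large: "\<forall>\<^sub>F n in sequentially. k \<le> K n" for k
  proof -
    have "\<forall>\<^sub>F n in sequentially. y n \<in> I k"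
      using y I_open I0 by (simp add: limitin_def)
    then show ?thesis
      using eventually_ge_at_top[of k]
    proof eventually_elim
      case (elim n)
      then show ?case
        unfolding K_def using ID by (intro Max_ge) auto
    qed
  qed

  \<comment> \<open>The approximating terms and their residuals\<close>
  have "\<exists>x \<alpha>. \<forall>j. x j \<in> H \<and> x j \<in> smul (of_real ((1/2) ^ j)) ` A (\<alpha> j) \<and> (\<forall>p<j. \<alpha> j p = r p) \<and>
      (j < K n \<longrightarrow> x j = 0 \<and> \<alpha> j = r) \<and> (K n \<le> j \<longrightarrow> y n - T (\<Sum>i<j. x i) \<in> D j)" for n
  proof -
    \<comment> \<open>\<rho> is the sequence of residuals. Before stage \<open>K n\<close> it rests
      at \<open>y n\<close>, with zero terms and index \<open>r\<close>; on reaching stage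
      \<open>K n\<close> it lies in \<open>D (K n)\<close> by \<open>K\<close>, and from there
      \<open>step\<close> applies.\<close>
    have "\<exists>\<rho>. \<forall>j. (j \<le> K n \<longrightarrow> \<rho> j = y n) \<and> (K n \<le> j \<longrightarrow> \<rho> j \<in> D j) \<and>
       (\<exists>x \<alpha>. x \<in> H \<and> x \<in> smul (of_real ((1/2) ^ j)) ` A \<alpha> \<and> (\<forall>p<j. \<alpha> p = r p) \<and>
         (j < K n \<longrightarrow> x = 0 \<and> \<alpha> = r) \<and> \<rho> (Suc j) = \<rho> j - T x)"
      (is "\<exists>\<rho>. \<forall>j. ?P j (\<rho> j) \<and> ?P' j (\<rho> j) \<and> ?Q j (\<rho> j) (\<rho> (Suc j))")
    proof -
      have "\<exists>\<rho>. \<forall>j. (?P j (\<rho> j) \<and> ?P' j (\<rho> j)) \<and> ?Q j (\<rho> j) (\<rho> (Suc j))"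
      proof (rule dependent_nat_choice)
        show "\<exists>z. ?P 0 z \<and> ?P' 0 z" using K[of n] by (auto intro!: exI[of _ "y n"])
      next
        fix z j assume z: "?P j z \<and> ?P' j z"
        show "\<exists>z'. (?P (Suc j) z' \<and> ?P' (Suc j) z') \<and> ?Q j z z'"
        proof (cases "j < K n")
          case True
          have "0 \<in> smul (of_real ((1/2) ^ j)) ` A r"
            using disk_zero[OF vector_space_axioms dA, of r] by force
          with True z H0 T0 K[of n] show ?thesis
            by (intro exI[of _ z]) (auto simp: le_antisym less_eq_Suc_le)
        next
          case False
          with z obtain x \<alpha> where "x \<in> H \<and> x \<in> smul (of_real ((1/2) ^ j)) ` A \<alpha> \<and>
              (\<forall>n<j. \<alpha> n = r n) \<and> z - T x \<in> D (Suc j)"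
            using step[of z j] by auto
          with False show ?thesis by (intro exI[of _ "z - T x"]) auto
        qed
      qed
      then show ?thesis by (simp only: conj_assoc)
    qed
    then obtain \<rho> where \<rho>: "\<And>j. j \<le> K n \<Longrightarrow> \<rho> j = y n" "\<And>j. K n \<le> j \<Longrightarrow> \<rho> j \<in> D j"
      "\<And>j. ?Q j (\<rho> j) (\<rho> (Suc j))"
      by blast
    from \<rho>(3) obtain x \<alpha> where x: "\<And>j. x j \<in> H \<and> x j \<in> smul (of_real ((1/2) ^ j)) ` A (\<alpha> j) \<and>
        (\<forall>p<j. \<alpha> j p = r p) \<and> (j < K n \<longrightarrow> x j = 0 \<and> \<alpha> j = r) \<and> \<rho> (Suc j) = \<rho> j - T (x j)"
      by metis
    have "\<rho> j = y n - T (\<Sum>i<j. x i)" for j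
    proof (induction j)
      case 0
      then show ?case using \<rho>(1) T0 by simp
    next
      case (Suc j)
      have "(\<Sum>i<j. x i) \<in> H" using x by (intro subspace_sum[OF subH]) auto
      moreover have "\<rho> (Suc j) = (y n - T (\<Sum>i<j. x i)) - T (x j)"
        using x[of j] unfolding Suc by blast
      ultimately show ?case using x[of j] by (simp add: Tadd diff_diff_eq)
    qed
    then show ?thesis
      using x \<rho>(2) by (intro exI[of _ x] exI[of _ \<alpha>]) (metis (no_types, lifting))
  qed
  then obtain x \<alpha> where
        xH: "\<And>n j. x n j \<in> H"
    and xA: "\<And>n j. x n j \<in> smul (of_real ((1/2) ^ j)) ` A (\<alpha> n j)"
    and \<alpha>: "\<And>n j p. p < j \<Longrightarrow> \<alpha> n j p = r p"
    and x0: "\<And>n j. j < K n \<Longrightarrow> x n j = 0"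
    and \<alpha>0: "\<And>n j. j < K n \<Longrightarrow> \<alpha> n j = r"
    and res: "\<And>n j. K n \<le> j \<Longrightarrow> y n - T (\<Sum>i<j. x n i) \<in> D j"
    by metis

  \<comment> \<open>One index above all approximating indices\<close>
  obtain \<beta> where \<beta>: "\<alpha> n j \<le> \<beta>" for n j
  proof -
    \<comment> \<open>Coordinate p of \<open>\<alpha> n j\<close> can differ from \<open>r p\<close>
      only if K n \<le> j \<le> p. As K n > p for all large n, finitely many pairs (n, j)
      remain.\<close>
    have fin: "finite ((\<lambda>i. (case i of (n, j) \<Rightarrow> \<alpha> n j) p) ` UNIV)" for p
    proof -
      obtain N where N: "\<And>n. N \<le> n \<Longrightarrow> Suc p \<le> K n"
        using K_large[of "Suc p"] unfolding eventually_sequentially by blast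
      have "\<alpha> n j p \<in> insert (r p) ((\<lambda>(n, j). \<alpha> n j p) ` ({..<N} \<times> {..p}))" for n j
      proof (cases "n < N \<and> j \<le> p")
        case True
        then show ?thesis
          by (intro insertI2 rev_image_eqI[where x = "(n, j)"]) simp_all
      next
        case False
        then have "p < j \<or> j < K n" using N[of n] by (cases "n < N") auto
        then have "\<alpha> n j p = r p" by (elim disjE) (simp_all add: \<alpha> \<alpha>0)
        then show ?thesis by simp
      qed
      then have "(\<lambda>i. (case i of (n, j) \<Rightarrow> \<alpha> n j) p) ` UNIV \<subseteq>
          insert (r p) ((\<lambda>(n, j). \<alpha> n j p) ` ({..<N} \<times> {..p}))"
        by auto
      then show ?thesis by (rule finite_subset) auto
    qed
    obtain \<beta> where \<beta>: "\<forall>i\<in>UNIV. (case i of (n, j) \<Rightarrow> \<alpha> n j) \<le> \<beta>"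
      using pointwise_bounded_upper_bound[of "\<lambda>(n, j). \<alpha> n j" UNIV, OF fin] ..
    show thesis
    proof (rule that[of \<beta>])
      show "\<alpha> n j \<le> \<beta>" for n j
        using \<beta>[rule_format, OF UNIV_I, of "(n, j)"] by simp
    qed
  qed

  \<comment> \<open>Summation in the Banach space spanned by \<open>A \<beta>\<close>\<close>
  have xB: "x n j \<in> smul (of_real ((1/2) ^ j)) ` A \<beta>" for n j
    using xA[of n j] mono[OF \<beta>[of n j]] by blast
  have xs: "x n j \<in> span (A \<beta>)" for n j
    by (rule scaled_in_span[OF vector_space_axioms _ xB]) simp
  let ?X = "\<lambda>n i. \<Sum>j<i. x n j"
  have XH: "?X n i \<in> H" for n i
    by (intro subspace_sum[OF subH] xH)
  have Xs: "?X n i \<in> span (A \<beta>)" for n i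
    by (intro span_sum xs)
  have "\<exists>u. u \<in> span (A \<beta>) \<and>
      limitin (mtopology_of (disk_metric smul (A \<beta>))) (?X n) u sequentially \<and>
      disk_norm smul (A \<beta>) u \<le> 2 * (1/2) ^ K n" for n
    by (rule banach_disk_geometric_series[of smul F "A \<beta>" "x n" "K n", OF lcs bd xB x0]) blast+
  then obtain u where u: "\<And>n. u n \<in> span (A \<beta>)"
      "\<And>n. limitin (mtopology_of (disk_metric smul (A \<beta>))) (?X n) (u n) sequentially"
      "\<And>n. disk_norm smul (A \<beta>) (u n) \<le> 2 * (1/2) ^ K n"
    by metis
  \<comment> \<open>The partial sums lie in \<open>H\<close> and converge in the norm of
    \<open>A \<beta>\<close>, for which the trace of \<open>H\<close> is closed because
    \<open>H\<close> is fast closed.\<close>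
  have uH: "u n \<in> H" for n
    using limitin_closedin[OF u(2) clH[OF bd]] XH Xs by auto
  have uF: "limitin F (?X n) (u n) sequentially" for n
    by (rule limitin_disk_metric_imp[OF lcs dA bA Xs u(2)])

  \<comment> \<open>The closed graph identifies the image of each sum\<close>
  have "T (u n) = y n" for n
  proof -
    have "(u n, y n) \<in> {(x, T x) |x. x \<in> H}"
    proof (rule ccontr)
      assume n: "(u n, y n) \<notin> {(x, T x) |x. x \<in> H}"
      have "openin (prod_topology (subtopology F H) E)
          (topspace (prod_topology (subtopology F H) E) - {(x, T x) |x. x \<in> H})"
        using graph by (simp add: closedin_def)
      moreover have "(u n, y n) \<in> topspace (prod_topology (subtopology F H) E) - {(x, T x) |x. x \<in> H}"
        using n uH y_in by (simp add: topF top)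
      ultimately obtain W U where W: "openin (subtopology F H) W" "u n \<in> W" and U: "openin E U" "y n \<in> U"
        and WU: "W \<times> U \<subseteq> topspace (prod_topology (subtopology F H) E) - {(x, T x) |x. x \<in> H}"
        unfolding openin_prod_topology_alt by meson
      have "\<exists>a \<gamma>. a \<in> H \<and> a \<in> smul (of_real ((1/2) ^ i)) ` A \<gamma> \<and> (\<forall>p<i. \<gamma> p = r p) \<and>
          T (?X n i) + T a \<in> U" if "K n \<le> i" for i
      proof -
        \<comment> \<open>This sum is \<open>y n\<close>. Its second term is a residual in
          \<open>D i\<close>, which \<open>meet\<close> replaces by some \<open>T a\<close> without
          leaving \<open>U\<close>.\<close>
        have "T (?X n i) + smul' 1 (y n - T (?X n i)) \<in> U"
          using U(2) by simp
        from meet[OF U(1) imageI[OF XH] one_neq_zero res[OF that] this]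
        show ?thesis by (simp only: E.scale_one)
      qed
      then obtain a \<gamma> where a: "\<And>i. K n \<le> i \<Longrightarrow> a i \<in> H"
          "\<And>i. K n \<le> i \<Longrightarrow> a i \<in> smul (of_real ((1/2) ^ i)) ` A (\<gamma> i)"
          "\<And>i. K n \<le> i \<Longrightarrow> T (?X n i) + T (a i) \<in> U"
          and \<gamma>: "\<And>i p. K n \<le> i \<Longrightarrow> p < i \<Longrightarrow> \<gamma> i p = r p"
        by metis
      \<comment> \<open>The indices \<gamma> depend on \<open>U\<close>, so \<beta> may fail to
        dominate them. They agree with \<open>r\<close> on growing segments, hence have a bound
        \<delta> of their own.\<close>
      have "finite ((\<lambda>i. \<gamma> i p) ` {K n..})" for p
      proof (rule finite_subset)
        show "(\<lambda>i. \<gamma> i p) ` {K n..} \<subseteq> insert (r p) ((\<lambda>i. \<gamma> i p) ` {..p})"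
        proof (rule image_subsetI)
          fix i assume "i \<in> {K n..}"
          then show "\<gamma> i p \<in> insert (r p) ((\<lambda>i. \<gamma> i p) ` {..p})"
            using \<gamma>[of i p] by (cases "i \<le> p") auto
        qed
      qed simp
      then obtain \<delta> where \<delta>: "\<forall>i\<in>{K n..}. \<gamma> i \<le> \<delta>"
        using pointwise_bounded_upper_bound[of \<gamma> "{K n..}"] by presburger
      \<comment> \<open>No \<open>a i\<close> was chosen below stage \<open>K n\<close>; the value 0
        there does not affect limits.\<close>
      define b where "b i = (if K n \<le> i then a i else 0)" for i
      have "b i \<in> smul (of_real ((1/2) ^ i)) ` A \<delta>" for i
      proof (cases "K n \<le> i")
        case True
        then have "A (\<gamma> i) \<subseteq> A \<delta>" using \<delta> by (intro mono) simp
        then show ?thesis using a(2)[OF True] True by (auto simp only: b_def if_True)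
      next
        case False
        have "0 \<in> smul (of_real ((1/2) ^ i)) ` A \<delta>"
          using disk_zero[OF vector_space_axioms dA] by (rule rev_image_eqI) simp
        with False show ?thesis by (simp add: b_def)
      qed
      moreover have "(\<lambda>i. (1/2) ^ i :: real) \<longlonglongrightarrow> 0"
        by (intro LIMSEQ_power_zero) simp
      ultimately have "limitin F b 0 sequentially"
        using limitin_scaled_bounded[OF lcs bA] by blast
      \<comment> \<open>The corrections tend to 0 in \<open>F\<close>, so the corrected partial sums
        still tend to \<open>u n\<close> and enter \<open>W'\<close>, while their images stay in
        \<open>U\<close>: a graph point in the rectangle meant to miss the graph.\<close>
      then have "limitin F (\<lambda>i. ?X n i + b i) (u n) sequentially"
        using limitin_add[OF lcs uF] by force
      moreover obtain W' where W': "openin F W'" "W = W' \<inter> H"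
        using W(1) by (auto simp: openin_subtopology)
      ultimately have "\<forall>\<^sub>F i in sequentially. ?X n i + b i \<in> W'"
        using W(2) by (simp add: limitin_def)
      then obtain i where i: "K n \<le> i" "?X n i + a i \<in> W'"
        unfolding eventually_sequentially b_def by (metis nat_le_linear)
      then have "(?X n i + a i, T (?X n i + a i)) \<in> W \<times> U"
        using a[OF i(1)] XH W'(2) by (simp add: Tadd subspace_add[OF subH])
      then show False
        using WU a(1)[OF i(1)] XH[of n i] subspace_add[OF subH] by blast
    qed
    then show ?thesis by auto
  qed

  \<comment> \<open>Fast convergence to 0, from the growth of the starting stages\<close>
  moreover have "fast_convergent smul F u"
  proof -
    have "(\<lambda>n. disk_norm smul (A \<beta>) (u n)) \<longlonglongrightarrow> 0"
    proof (rule tendsto_sandwich)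
      interpret M: Metric_space "span (A \<beta>)" "\<lambda>x y. disk_norm smul (A \<beta>) (x - y)"
        using lcs dA bA by (rule Metric_space_disk)
      show "\<forall>\<^sub>F n in sequentially. 0 \<le> disk_norm smul (A \<beta>) (u n)"
        using M.nonneg[of _ 0] by simp
      show "\<forall>\<^sub>F n in sequentially. disk_norm smul (A \<beta>) (u n) \<le> 2 * (1/2) ^ K n"
        using u(3) by simp
      have "filterlim K at_top sequentially"
        using K_large by (simp add: filterlim_at_top)
      moreover have "(\<lambda>i. 2 * (1/2) ^ i :: real) \<longlonglongrightarrow> 0"
        by (intro tendsto_mult_right_zero LIMSEQ_power_zero) simp
      ultimately show "(\<lambda>n. 2 * (1/2) ^ K n :: real) \<longlonglongrightarrow> 0"
        by (rule filterlim_compose[rotated])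
    qed simp
    then have "limitin (mtopology_of (disk_metric smul (A \<beta>))) u 0 sequentially"
      using limitin_disk_metric_iff[OF lcs dA bA u(1)] span_zero by simp
    then show ?thesis
      unfolding fast_convergent_def using bd u(1) by blast
  qed
  ultimately show ?thesis
    using u(1) uH by blast
qed

section \<open>The normal topology\<close>

text \<open>Multiplication by a positive t is monotone and continuous, hence commutes with the
  supremum of a bounded set. It preserves unboundedness, and all unbounded sets share one junk
  supremum.\<close>

lemma SUP_mult_left_or_unbounded:
  fixes g :: "'i \<Rightarrow> real"
  assumes "V \<noteq> {}" and "0 < t"
  shows "(SUP i\<in>V. t * g i) = t * (SUP i\<in>V. g i) \<or>
    (SUP i\<in>V. t * g i) = Sup UNIV \<and> (SUP i\<in>V. g i) = Sup UNIV"
proof (cases "bdd_above (g ` V)")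
  case True
  have "(SUP i\<in>V. t * g i) = t * (SUP i\<in>V. g i)"
    using continuous_at_Sup_mono[of "(*) t" "g ` V"] assms True
    by (simp add: mono_def image_image continuous_mult_left)
  then show ?thesis ..
next
  case False
  text \<open>The real supremum of an unbounded set is the unspecified value \<open>LEAST z. False\<close>.\<close>
  have Sup: "Sup X = Sup UNIV" if "\<not> bdd_above X" for X :: "real set"
  proof -
    have "(\<lambda>z. \<forall>x\<in>X. x \<le> z) = (\<lambda>z. False)"
      using that by (auto simp: bdd_above_def fun_eq_iff)
    moreover have "(\<lambda>z::real. \<forall>x\<in>UNIV. x \<le> z) = (\<lambda>z. False)"
    proof
      fix z :: real
      have "\<not> z + 1 \<le> z" by simp
      then show "(\<forall>x\<in>UNIV. x \<le> z) = False" by blast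
    qed
    ultimately show ?thesis unfolding Sup_real_def by simp
  qed
  have "\<not> bdd_above ((\<lambda>i. t * g i) ` V)"
  proof
    assume "bdd_above ((\<lambda>i. t * g i) ` V)"
    then obtain M where "\<And>i. i \<in> V \<Longrightarrow> t * g i \<le> M"
      by (auto simp: bdd_above_def)
    then have "bdd_above (g ` V)"
      using \<open>0 < t\<close> by (auto simp: bdd_above_def field_simps intro!: exI[of _ "M / t"])
    with False show False ..
  qed
  with False show ?thesis using Sup by metis
qed

text \<open>Weaker than homogeneity in that it also holds for functions \<open>p\<close> that are given by suprema
  and are infinite, that is, take a junk value, at some points.\<close>

definition scalable ::
  "('k::real_or_complex \<Rightarrow> 'v::ab_group_add \<Rightarrow> 'v) \<Rightarrow> ('v \<Rightarrow> real) \<Rightarrow> bool" where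
  "scalable smul p \<longleftrightarrow> (\<forall>c\<noteq>0. \<forall>e>0. \<exists>d>0. \<forall>z. p z < d \<longrightarrow> p (smul c z) < e)"

lemma scalable_SUP:
  fixes smul :: "'k::real_or_complex \<Rightarrow> 'v::ab_group_add \<Rightarrow> 'v"
  assumes "V \<noteq> {}" and g: "\<And>i c z. g i (smul c z) = norm c * g i z"
  shows "scalable smul (\<lambda>z. SUP i\<in>V. g i z)"
  unfolding scalable_def
proof (intro allI impI)
  let ?s = "Sup UNIV :: real"
  fix c :: 'k and e :: real assume c: "c \<noteq> 0" and e: "0 < e"
  \<comment> \<open>The bound e / norm c serves the homogeneous case. A positive junk value
    \<open>?s\<close> is excluded by d \<le> \<open>?s\<close>; a nonpositive one is below e
    anyway.\<close>
  define d where "d = (if 0 < ?s then min (e / norm c) ?s else e / norm c)"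
  have "(SUP i\<in>V. g i (smul c z)) < e" if z: "(SUP i\<in>V. g i z) < d" for z
  proof -
    have "(SUP i\<in>V. g i (smul c z)) = norm c * (SUP i\<in>V. g i z) \<or>
        (SUP i\<in>V. g i (smul c z)) = ?s \<and> (SUP i\<in>V. g i z) = ?s"
      unfolding g using SUP_mult_left_or_unbounded[OF assms(1), of "norm c" "\<lambda>i. g i z"] c by simp
    moreover have "norm c * (SUP i\<in>V. g i z) < e"
    proof -
      have "(SUP i\<in>V. g i z) < e / norm c"
        using z by (auto simp: d_def split: if_splits)
      then show ?thesis using c by (simp add: field_simps)
    qed
    moreover have "?s < e" if "(SUP i\<in>V. g i z) = ?s"
      using z that e by (auto simp: d_def split: if_splits)
    ultimately show ?thesis by argo
  qed
  moreover have "0 < d" using c e by (simp add: d_def)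
  ultimately show "\<exists>d>0. \<forall>z. (SUP i\<in>V. g i z) < d \<longrightarrow> (SUP i\<in>V. g i (smul c z)) < e"
    by blast
qed

text \<open>Translations cancel in the differences that define the topology, so only the factor
  \<open>c\<close> matters; \<open>scalable\<close> absorbs it, with the least of finitely many
  radii.\<close>

lemma openin_seminorm_topology_affine:
  fixes smul :: "'k::real_or_complex \<Rightarrow> 'v::ab_group_add \<Rightarrow> 'v"
  assumes "vector_space smul" and S: "module.subspace smul S"
    and P: "\<And>p. p \<in> P \<Longrightarrow> scalable smul p"
    and U: "openin (seminorm_topology S P) U" and a: "a \<in> S" and c: "c \<noteq> 0"
  shows "openin (seminorm_topology S P) {z \<in> S. a + smul c z \<in> U}"
  unfolding openin_seminorm_topology
proof (intro conjI ballI)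
  interpret vector_space smul by fact
  fix x assume "x \<in> {z \<in> S. a + smul c z \<in> U}"
  then have x: "x \<in> S" "a + smul c x \<in> U" by auto
  with U obtain Q e where Q: "finite Q" "Q \<subseteq> P" "0 < e"
    and QU: "{y \<in> S. \<forall>p\<in>Q. p (y - (a + smul c x)) < e} \<subseteq> U"
    unfolding openin_seminorm_topology by blast
  have "\<forall>p\<in>Q. \<exists>d>0. \<forall>z. p z < d \<longrightarrow> p (smul c z) < e"
    using P Q c by (auto simp: scalable_def)
  then obtain d where d: "\<And>p. p \<in> Q \<Longrightarrow> 0 < d p"
      "\<And>p z. p \<in> Q \<Longrightarrow> p z < d p \<Longrightarrow> p (smul c z) < e"
    by metis
  \<comment> \<open>The inserted 1 covers the case of empty \<open>Q\<close>.\<close>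
  define m where "m = Min (insert 1 (d ` Q))"
  have m: "0 < m" "\<And>p. p \<in> Q \<Longrightarrow> m \<le> d p"
    using Q(1) d(1) by (auto simp: m_def)
  have "a + smul c z \<in> U" if z: "z \<in> S" "\<forall>p\<in>Q. p (z - x) < m" for z
  proof -
    have "p (smul c (z - x)) < e" if "p \<in> Q" for p
      using z m(2)[OF that] that by (intro d(2)) (auto intro: less_le_trans)
    moreover have "a + smul c z \<in> S"
      using S a z by (intro subspace_add subspace_scale)
    ultimately show ?thesis
      using QU by (auto simp: scale_right_diff_distrib)
  qed
  then show "\<exists>Q e. finite Q \<and> Q \<subseteq> P \<and> 0 < e \<and>
      {z \<in> S. \<forall>p\<in>Q. p (z - x) < e} \<subseteq> {z \<in> S. a + smul c z \<in> U}"
    using Q m(1) by (intro exI[of _ Q] exI[of _ m]) auto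
qed auto

lemma fourier_localized_scale:
  "fourier_localized (pscale c u) \<phi> \<xi> = cplx c * fourier_localized u \<phi> \<xi>"
  by (simp add: fourier_localized_def pscale_def cplx_mult algebra_simps)

text \<open>Both kinds of defining seminorms are suprema, over nonempty index sets, of absolutely
  homogeneous functions, so \<open>scalable_SUP\<close> applies.\<close>

lemma openin_normal_topology_affine:
  fixes \<Omega> :: "(real^'d::finite) set" and c :: "'k::real_or_complex"
  assumes "module.subspace (pscale :: 'k \<Rightarrow> _) (distributions_WF \<Omega> \<Gamma>)"
    and "openin (normal_topology \<Omega> \<Gamma>) U" and "a \<in> distributions_WF \<Omega> \<Gamma>" and "c \<noteq> 0"
  shows "openin (normal_topology \<Omega> \<Gamma>) {z \<in> distributions_WF \<Omega> \<Gamma>. a + pscale c z \<in> U}"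
proof -
  have "scalable pscale (seminorm_bounded B)"
    if "B \<noteq> {}" for B :: "(real^'d \<Rightarrow> 'k) set"
    using scalable_SUP[OF that, of "\<lambda>f u. norm (u f)" pscale]
    by (simp add: seminorm_bounded_def[abs_def] pscale_def norm_mult)
  moreover have "scalable pscale (seminorm_WF N V \<phi>)"
    if "V \<noteq> {}" for N V and \<phi> :: "real^'d \<Rightarrow> 'k"
    using scalable_SUP[OF that, of "\<lambda>\<xi> u. (1 + norm \<xi>) ^ N * norm (fourier_localized u \<phi> \<xi>)" pscale]
    by (simp add: seminorm_WF_def[abs_def] fourier_localized_scale norm_mult norm_cplx mult_ac)
  ultimately have "scalable pscale p"
    if "p \<in> {seminorm_bounded B |B. B \<noteq> {} \<and> bounded_in pscale (test_topology \<Omega>) B} \<union>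
      {seminorm_WF N V \<phi> |N V \<phi>. \<phi> \<in> test_functions \<Omega> \<and> V \<noteq> {} \<and> closed V \<and> cone V \<and>
         (supp \<phi> \<times> V) \<inter> \<Gamma> = {}}" for p :: "('k, 'd) functional \<Rightarrow> real"
    using that by blast
  then show ?thesis
    using assms unfolding normal_topology_def
    by (intro openin_seminorm_topology_affine[OF vector_space_pscale])
qed

theorem corollary2:
  fixes \<Omega> :: "(real^'d::finite) set"
    and \<Gamma> :: "((real^'d) \<times> (real^'d)) set"
    and smul :: "'k::real_or_complex \<Rightarrow> 'f::ab_group_add \<Rightarrow> 'f"
    and F :: "'f topology"
    and A :: "(nat \<Rightarrow> nat) \<Rightarrow> 'f set"
    and H :: "'f set"
    and T :: "'f \<Rightarrow> ('k, 'd) functional"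
    and r :: "nat \<Rightarrow> nat"
    and y :: "nat \<Rightarrow> ('k, 'd) functional"
  assumes "open \<Omega>"
    and "closed_cone_over \<Omega> \<Gamma>"
    and "locally_convex_space smul F"
    and "quasi_LB_representation smul F A"
    and "fast_closed smul F H"
    and "linear_map_on smul pscale H T"
    and "T ` H = distributions_WF \<Omega> \<Gamma>"
    and "closedin (prod_topology (subtopology F H) (normal_topology \<Omega> \<Gamma>)) {(x, T x) |x. x \<in> H}"
    and "\<And>k. k \<ge> 1 \<Longrightarrow>
      0 \<in> normal_topology \<Omega> \<Gamma> interior_of (normal_topology \<Omega> \<Gamma> closure_of image_union A H T r k)"
    and "\<And>n. y n \<in> distributions_WF \<Omega> \<Gamma>"
    and "limitin (normal_topology \<Omega> \<Gamma>) y 0 sequentially"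
  shows "\<exists>\<beta> u. (\<forall>n. u n \<in> module.span smul (A \<beta>) \<inter> H) \<and>
           fast_convergent smul F u \<and> (\<forall>n. T (u n) = y n)"
proof -
  have vs: "vector_space smul" and vs': "vector_space (pscale :: 'k \<Rightarrow> ('k, 'd) functional \<Rightarrow> _)"
    using assms(3) vector_space_pscale by (auto simp: locally_convex_space_def)
  interpret vector_space smul by fact
  interpret E: vector_space "pscale :: 'k \<Rightarrow> ('k, 'd) functional \<Rightarrow> _" by fact
  \<comment> \<open>By surjectivity the target is the image of \<open>H\<close>, so it inherits
    linearity through \<open>T\<close>, without a study of wavefront sets.\<close>
  have "E.subspace (T ` H)"
    using assms(5,6) by (intro linear_map_on_image_subspace[OF vs vs']) (auto simp: fast_closed_def)
  then have "E.subspace (distributions_WF \<Omega> \<Gamma>)"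
    by (simp add: assms(7))
  note affine = openin_normal_topology_affine[OF this]
  show ?thesis
  proof (rule fast_convergent_lifting[OF assms(3-5) vs' assms(6) _ _ assms(8,9,11)])
    show "topspace (normal_topology \<Omega> \<Gamma>) = T ` H"
      by (simp add: normal_topology_def assms(7))
  qed (use affine assms(7,10) in auto)
qed

end
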